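(* Let $f:\mathbb{R}\to\mathbb{R}$ be a $C^1$ capitalization factor, let $\delta_f=f'/f$, and let $e_0=(t_0,h_0,c_0)\in\mathbb{R}^3$ be a capitalized event with $c_0\neq 0$. Then the evolution $\mu_{e_0}$, with respect to $f$, of the origin $e_0$ of the Lie semigroup $\mathbb{R}^3_{e_0}=(\mathbb{R}^3,[\cdot|\cdot]_{(f,e_0)})$ is the exponential map of the translated Lie group $\mathbb{R}_{t_0}=(\mathbb{R},+_{t_0})$ into $\mathbb{R}^3_{e_0}$ with respect to the tangent vector $v=(1,1,c_0\,\delta_f(h_0))$ at $e_0$; that is, $\mu_{e_0}$ is the unique $C^1$ homomorphism from $(\mathbb{R},+_{t_0})$ to $\mathbb{R}^3_{e_0}$ which sends $t_0$ to $e_0$ and has derivative $(1,1,c_0\,\delta_f(h_0))$ at $t_0$.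
   Context: A capitalized (financial) event is any triple $(t,h,c)$ of real numbers. A $C^1$ capitalization factor is a function $f:\mathbb{R}\to\mathbb{R}$ of class $C^1$ such that $f(h)>0$ for all $h$, $f(0)=1$, and $f(-h)=f(h)^{-1}$ for all $h\in\mathbb{R}$. Its force of interest is $\delta_f:\mathbb{R}\to\mathbb{R}$, $\delta_f(h)=f'(h)/f(h)$. The translated addition is $t+_{t_0}t'=t+t'-t_0$, which makes $\mathbb{R}$ a Lie group $\mathbb{R}_{t_0}$ with neutral element $t_0$. The product induced by $f$ and centered at $e_0=(t_0,h_0,c_0)$ is defined for $e=(t,h,c)$ and $e'=(t',h',c')$ by $$[e|e']_{(f,e_0)}=\left(t+(t'-t_0),\ h+h'-h_0,\ \frac{c}{f(h)}\,\frac{c'}{f(h')}\,\frac{c_0^{-1}}{f(-h_0)}\,f(h+h'-h_0)\right);$$ it is associative, commutative and $C^1$, with neutral element (origin) $e_0$. The evolution of $e_0$ with respect to $f$ is the curve $$\mu_{e_0}:\mathbb{R}\to\mathbb{R}^3,\qquad \mu_{e_0}(t)=\bigl(t,\,h_0+t-t_0,\,c_0f(-h_0)f(h_0+t-t_0)\bigr).$$ The exponential map of $\mathbb{R}_{t_0}$ into $\mathbb{R}^3_{e_0}$ with respect to a tangent vector $v$ at $e_0$ is the unique $C^1$ homomorphism $\mu:(\mathbb{R},+_{t_0})\to\mathbb{R}^3_{e_0}$ (with $\mu(t_0)=e_0$) such that $\mu'(t_0)=v$. *)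

theory Defs
  imports "HOL-Analysis.Analysis" "HOL-Algebra.Group"
begin

type_synonym event = "real \<times> real \<times> real"

definition C1_capitalization_factor :: "(real \<Rightarrow> real) \<Rightarrow> bool" where
  "C1_capitalization_factor f \<longleftrightarrow>
     f C1_differentiable_on UNIV \<and> (\<forall>h. f h > 0) \<and> f 0 = 1 \<and> (\<forall>h. f (- h) = inverse (f h))"

definition force_of_interest :: "(real \<Rightarrow> real) \<Rightarrow> real \<Rightarrow> real" where
  "force_of_interest f h = deriv f h / f h"

definition translated_group :: "real \<Rightarrow> real monoid" where
  "translated_group t0 = \<lparr>carrier = UNIV, mult = (\<lambda>t t'. t + t' - t0), one = t0\<rparr>"

fun event_product :: "(real \<Rightarrow> real) \<Rightarrow> event \<Rightarrow> event \<Rightarrow> event \<Rightarrow> event" where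
  "event_product f (t0, h0, c0) (t, h, c) (t', h', c') =
     (t + (t' - t0),
      h + h' - h0,
      (c / f h) * (c' / f h') * (inverse c0 / f (- h0)) * f (h + h' - h0))"

definition event_monoid :: "(real \<Rightarrow> real) \<Rightarrow> event \<Rightarrow> event monoid" where
  "event_monoid f e0 = \<lparr>carrier = UNIV, mult = event_product f e0, one = e0\<rparr>"

fun evolution :: "(real \<Rightarrow> real) \<Rightarrow> event \<Rightarrow> real \<Rightarrow> event" where
  "evolution f (t0, h0, c0) t = (t, h0 + t - t0, c0 * f (- h0) * f (h0 + t - t0))"

text \<open>
  The tangent space of \<open>\<real>\<^sup>3\<close> at any event is identified with \<open>\<real>\<^sup>3\<close>, so the velocity of a curve is its
  vector derivative. Since \<^const>\<open>hom\<close> does not require preservation of the neutral element,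
  and the target is only a monoid, that condition is stated separately.
\<close>

definition C1_homomorphism_with_velocity ::
    "real \<Rightarrow> ('a::real_normed_vector) monoid \<Rightarrow> 'a \<Rightarrow> (real \<Rightarrow> 'a) \<Rightarrow> bool" where
  "C1_homomorphism_with_velocity t0 H v \<mu> \<longleftrightarrow>
     \<mu> \<in> hom (translated_group t0) H \<and>
     \<mu> C1_differentiable_on UNIV \<and>
     \<mu> t0 = \<one>\<^bsub>H\<^esub> \<and>
     (\<mu> has_vector_derivative v) (at t0)"

definition is_exponential_map ::
    "real \<Rightarrow> ('a::real_normed_vector) monoid \<Rightarrow> 'a \<Rightarrow> (real \<Rightarrow> 'a) \<Rightarrow> bool" where
  "is_exponential_map t0 H v \<mu> \<longleftrightarrow>
     C1_homomorphism_with_velocity t0 H v \<mu> \<and>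
     (\<forall>\<nu>. C1_homomorphism_with_velocity t0 H v \<nu> \<longrightarrow> \<nu> = \<mu>)"

lemma comm_group_translated_group: "comm_group (translated_group t0)"
proof (rule comm_groupI)
  fix x assume "x \<in> carrier (translated_group t0)"
  show "\<exists>y\<in>carrier (translated_group t0). y \<otimes>\<^bsub>translated_group t0\<^esub> x = \<one>\<^bsub>translated_group t0\<^esub>"
    by (rule bexI[of _ "2 * t0 - x"]) (simp_all add: translated_group_def)
qed (simp_all add: translated_group_def)

lemma comm_monoid_event_monoid:
  assumes f: "C1_capitalization_factor f" and c0: "c0 \<noteq> 0"
  shows "comm_monoid (event_monoid f (t0, h0, c0))"
proof -
  have nz: "f h \<noteq> 0" for h
    using f unfolding C1_capitalization_factor_def by (metis less_irrefl)
  have inv: "f (- h) = inverse (f h)" for h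
    using f unfolding C1_capitalization_factor_def by blast
  show ?thesis
  proof (rule comm_monoidI)
    fix x y z :: event
    obtain t h c t' h' c' t'' h'' c''
      where xyz: "x = (t, h, c)" "y = (t', h', c')" "z = (t'', h'', c'')"
      by (metis prod_cases3)
    have *: "h + h' - h0 + h'' - h0 = h + (h' + h'' - h0) - h0"
      by simp
    show "x \<otimes>\<^bsub>event_monoid f (t0, h0, c0)\<^esub> y \<otimes>\<^bsub>event_monoid f (t0, h0, c0)\<^esub> z
        = x \<otimes>\<^bsub>event_monoid f (t0, h0, c0)\<^esub> (y \<otimes>\<^bsub>event_monoid f (t0, h0, c0)\<^esub> z)"
      using nz by (simp add: event_monoid_def xyz * field_simps)
    show "x \<otimes>\<^bsub>event_monoid f (t0, h0, c0)\<^esub> y = y \<otimes>\<^bsub>event_monoid f (t0, h0, c0)\<^esub> x"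
      by (simp add: event_monoid_def xyz algebra_simps)
    show "\<one>\<^bsub>event_monoid f (t0, h0, c0)\<^esub> \<otimes>\<^bsub>event_monoid f (t0, h0, c0)\<^esub> x = x"
      using nz c0 by (simp add: event_monoid_def xyz inv field_simps)
  qed (simp_all add: event_monoid_def)
qed

end

theory Submission imports Defs begin

text \<open>
  In the coordinates \<open>s = t - t0\<close>, the first two components of a homomorphism, recentred at \<open>e0\<close>,
  are additive, and the third one, divided by the third component of the evolution, is a
  homomorphism from \<open>(\<real>, +)\<close> to \<open>(\<real>, *)\<close>. A differentiable homomorphism of this kind is determined
  by its derivative at \<open>0\<close>; here the multiplicative one has derivative \<open>0\<close>, so it is constantly \<open>1\<close>.
\<close>

text \<open>Additivity carries the derivative at 0 to every point: near \<open>y\<close>,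
  \<open>\<phi>\<close> is its own germ at 0 shifted by the constant \<open>\<phi> y\<close>. Hence
  \<open>\<phi> y - k * y\<close> has zero derivative everywhere and is constant.\<close>

lemma additive_eq_linear:
  fixes \<phi> :: "real \<Rightarrow> real"
  assumes add: "\<And>x y. \<phi> (x + y) = \<phi> x + \<phi> y"
    and deriv: "(\<phi> has_real_derivative k) (at 0)"
  shows "\<phi> x = k * x"
proof -
  have "(\<phi> has_real_derivative k) (at y)" for y
  proof -
    have "((\<lambda>s. \<phi> y + \<phi> s) has_real_derivative k) (at 0)"
      by (auto intro!: derivative_eq_intros deriv)
    then show ?thesis
      by (simp add: DERIV_shift[of _ _ 0 y, simplified] add add.commute)
  qed
  then have "((\<lambda>y. \<phi> y - k * y) has_real_derivative 0) (at y)" for y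
    by (auto intro!: derivative_eq_intros)
  then have "\<phi> x - k * x = \<phi> 0 - k * 0"
    by (intro DERIV_isconst_all) blast
  with add[of 0 0] show ?thesis by simp
qed

text \<open>Differentiating \<open>g (y + s) = g y * g s\<close> at \<open>s = 0\<close> gives the
  equation g' = k g on the whole line, and the integrating factor \<open>exp (- (k * y))\<close>
  turns \<open>g\<close> into a constant.\<close>

lemma multiplicative_eq_exp:
  fixes g :: "real \<Rightarrow> real"
  assumes mult: "\<And>x y. g (x + y) = g x * g y" and one: "g 0 = 1"
    and deriv: "(g has_real_derivative k) (at 0)"
  shows "g x = exp (k * x)"
proof -
  have g': "(g has_real_derivative g y * k) (at y)" for y
  proof -
    have "((\<lambda>s. g y * g s) has_real_derivative g y * k) (at 0)"
      by (auto intro!: derivative_eq_intros deriv)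
    then show ?thesis
      by (simp add: DERIV_shift[of _ _ 0 y, simplified] mult mult.commute)
  qed
  have "((\<lambda>y. g y * exp (- (k * y))) has_real_derivative 0) (at y)" for y
    by (auto intro!: derivative_eq_intros g')
  then have "g x * exp (- (k * x)) = g 0 * exp (- (k * 0))"
    by (intro DERIV_isconst_all) blast
  then show ?thesis by (simp add: one exp_minus field_simps)
qed

lemma C1_capitalization_factor_nonzero:
  "C1_capitalization_factor f \<Longrightarrow> f h \<noteq> 0"
  unfolding C1_capitalization_factor_def by (metis less_irrefl)

lemma C1_capitalization_factor_minus:
  "C1_capitalization_factor f \<Longrightarrow> f (- h) = inverse (f h)"
  unfolding C1_capitalization_factor_def by blast

text \<open>Being of class C1 only provides some continuous derivative \<open>D\<close>; uniqueness
  of derivatives identifies it with the \<open>deriv f\<close> that occurs in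
  \<open>force_of_interest\<close>.\<close>

lemma C1_capitalization_factor_deriv:
  assumes "C1_capitalization_factor f"
  shows "(f has_real_derivative deriv f h) (at h)" "continuous_on UNIV (deriv f)"
proof -
  obtain D where D: "\<And>x. (f has_vector_derivative D x) (at x)" "continuous_on UNIV D"
    using assms unfolding C1_capitalization_factor_def C1_differentiable_on_def by blast
  then have "(f has_real_derivative D x) (at x)" for x
    by (simp add: has_real_derivative_iff_has_vector_derivative)
  moreover from this have "deriv f = D" by (auto intro: DERIV_imp_deriv)
  ultimately show "(f has_real_derivative deriv f h) (at h)" "continuous_on UNIV (deriv f)"
    using D by auto
qed

lemma evolution_has_vector_derivative:
  assumes "C1_capitalization_factor f"
  shows "(evolution f (t0, h0, c0) has_vector_derivative
      (1, 1, c0 * f (- h0) * deriv f (h0 + t - t0))) (at t)"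
proof -
  have "((\<lambda>t. c0 * f (- h0) * f (h0 + t - t0)) has_real_derivative
      c0 * f (- h0) * deriv f (h0 + t - t0)) (at t)"
    by (rule derivative_eq_intros refl
        DERIV_chain'[OF _ C1_capitalization_factor_deriv(1)[OF assms]])+ simp
  moreover have "((\<lambda>t. h0 + t - t0) has_real_derivative 1) (at t)"
    by (auto intro!: derivative_eq_intros)
  ultimately have "((\<lambda>t. (t, h0 + t - t0, c0 * f (- h0) * f (h0 + t - t0))) has_vector_derivative
      (1, 1, c0 * f (- h0) * deriv f (h0 + t - t0))) (at t)"
    unfolding has_real_derivative_iff_has_vector_derivative
    by (intro has_vector_derivative_Pair has_vector_derivative_id)
  then show ?thesis by (simp add: evolution.simps[abs_def])
qed

text \<open>In the product of two values of the evolution the factors \<open>f h\<close> and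
  \<open>f h'\<close> cancel, and so does one copy of \<open>c0 * f (- h0)\<close>. The velocity has
  the required form because \<open>f (- h0)\<close> is the inverse of \<open>f h0\<close>.\<close>

lemma evolution_C1_homomorphism_with_velocity:
  assumes f: "C1_capitalization_factor f" and c0: "c0 \<noteq> 0"
  shows "C1_homomorphism_with_velocity t0 (event_monoid f (t0, h0, c0))
           (1, 1, c0 * force_of_interest f h0) (evolution f (t0, h0, c0))"
  unfolding C1_homomorphism_with_velocity_def
proof (intro conjI)
  note nz = C1_capitalization_factor_nonzero[OF f]
  note minus = C1_capitalization_factor_minus[OF f]
  note deriv = evolution_has_vector_derivative[OF f]
  \<comment> \<open>Rewrites the second component at the translated sum of \<open>t\<close> and
    \<open>t'\<close> into the shape that \<open>event_product\<close> yields.\<close>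
  have *: "h0 + (t + t' - t0) - t0 = h0 + t - t0 + (h0 + t' - t0) - h0" for t t'
    by simp
  show "evolution f (t0, h0, c0) \<in> hom (translated_group t0) (event_monoid f (t0, h0, c0))"
    using nz c0
    by (auto simp: hom_def translated_group_def event_monoid_def * minus)
  have "continuous_on UNIV (\<lambda>t. deriv f (h0 + t - t0))"
    by (intro continuous_on_compose2[OF C1_capitalization_factor_deriv(2)[OF f]]
        continuous_intros) auto
  then show "evolution f (t0, h0, c0) C1_differentiable_on UNIV"
    unfolding C1_differentiable_on_def using deriv
    by (intro exI[of _ "\<lambda>t. (1, 1, c0 * f (- h0) * deriv f (h0 + t - t0))"])
      (auto intro!: continuous_intros)
  show "evolution f (t0, h0, c0) t0 = \<one>\<^bsub>event_monoid f (t0, h0, c0)\<^esub>"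
    using nz by (simp add: event_monoid_def minus)
  show "(evolution f (t0, h0, c0) has_vector_derivative
      (1, 1, c0 * force_of_interest f h0)) (at t0)"
    using deriv[of t0 h0 c0 t0] by (simp add: force_of_interest_def minus field_simps)
qed

lemma C1_homomorphism_with_velocity_eq_evolution:
  assumes f: "C1_capitalization_factor f" and c0: "c0 \<noteq> 0"
    and \<nu>: "C1_homomorphism_with_velocity t0 (event_monoid f (t0, h0, c0))
           (1, 1, c0 * force_of_interest f h0) \<nu>"
  shows "\<nu> = evolution f (t0, h0, c0)"
proof
  note nz = C1_capitalization_factor_nonzero[OF f]
  note minus = C1_capitalization_factor_minus[OF f]
  define T where "T s = fst (\<nu> (t0 + s)) - t0" for s
  define H where "H s = fst (snd (\<nu> (t0 + s))) - h0" for s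
  define C where "C s = snd (snd (\<nu> (t0 + s)))" for s
  have \<nu>_eq: "\<nu> (t0 + s) = (t0 + T s, h0 + H s, C s)" for s
    by (simp add: T_def H_def C_def)
  \<comment> \<open>The translated sum of \<open>t0 + s\<close> and \<open>t0 + s'\<close> is
    \<open>t0 + (s + s')\<close>, so ordinary addition of the parameters corresponds to the event
    product.\<close>
  have hom: "\<nu> (t0 + (s + s')) = event_product f (t0, h0, c0) (\<nu> (t0 + s)) (\<nu> (t0 + s'))" for s s'
  proof -
    have "\<nu> (x + y - t0) = event_product f (t0, h0, c0) (\<nu> x) (\<nu> y)" for x y
      using \<nu> by (auto simp: C1_homomorphism_with_velocity_def hom_def translated_group_def
          event_monoid_def)
    from this[of "t0 + s" "t0 + s'"] show ?thesis by (simp add: algebra_simps)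
  qed
  have \<nu>0: "\<nu> t0 = (t0, h0, c0)"
    using \<nu> by (simp add: C1_homomorphism_with_velocity_def event_monoid_def)
  have "((\<lambda>s. \<nu> (t0 + s)) has_vector_derivative (1, 1, c0 * force_of_interest f h0)) (at 0)"
  proof -
    have "(\<nu> has_vector_derivative (1, 1, c0 * force_of_interest f h0)) (at (t0 + 0))"
      using \<nu> by (simp add: C1_homomorphism_with_velocity_def)
    moreover have "((\<lambda>s. t0 + s) has_vector_derivative 1) (at 0)"
      by (auto intro!: derivative_eq_intros)
    ultimately show ?thesis
      using vector_diff_chain_at[of "\<lambda>s. t0 + s" 1 0 \<nu>] by (simp add: o_def)
  qed
  then have deriv: "((\<lambda>s. \<nu> (t0 + s)) has_derivative
      (\<lambda>x. x *\<^sub>R (1, 1, c0 * force_of_interest f h0))) (at 0)"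
    by (simp add: has_vector_derivative_def)
  have "((\<lambda>s. fst (\<nu> (t0 + s)) - t0) has_real_derivative 1) (at 0)"
    using has_derivative_diff[OF has_derivative_fst[OF deriv] has_derivative_const[of t0]]
    by (simp add: has_field_derivative_def flip: lambda_one)
  then have T': "(T has_real_derivative 1) (at 0)" by (simp add: T_def[abs_def])
  have "((\<lambda>s. fst (snd (\<nu> (t0 + s))) - h0) has_real_derivative 1) (at 0)"
    using has_derivative_diff[OF has_derivative_fst[OF has_derivative_snd[OF deriv]]
        has_derivative_const[of h0]]
    by (simp add: has_field_derivative_def flip: lambda_one)
  then have H': "(H has_real_derivative 1) (at 0)" by (simp add: H_def[abs_def])
  have C': "(C has_real_derivative c0 * force_of_interest f h0) (at 0)"
    using has_derivative_snd[OF has_derivative_snd[OF deriv]]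
    by (simp add: has_field_derivative_def mult_commute_abs C_def[abs_def])
  have "T (s + s') = T s + T s'" for s s'
    using hom[of s s'] by (simp add: \<nu>_eq)
  from additive_eq_linear[OF this T'] have T: "T s = s" for s
    by simp
  have "H (s + s') = H s + H s'" for s s'
    using hom[of s s'] by (simp add: \<nu>_eq)
  from additive_eq_linear[OF this H'] have H: "H s = s" for s
    by simp
  \<comment> \<open>With \<open>H s = s\<close> known, every argument of \<open>f\<close> in the
    product is explicit, and the third component becomes a functional equation for \<open>C\<close>
    alone.\<close>
  have C_add: "C (s + s') = (C s / f (h0 + s)) * (C s' / f (h0 + s'))
      * (inverse c0 / f (- h0)) * f (h0 + (s + s'))" for s s'
  proof -
    have "h0 + s + (h0 + s') - h0 = h0 + (s + s')" by simp
    with hom[of s s'] show ?thesis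
      by (simp only: \<nu>_eq H event_product.simps prod.inject)
  qed
  \<comment> \<open>The denominator is the third component of the evolution at
    \<open>t0 + s\<close>; dividing by it removes all values of \<open>f\<close> from
    \<open>C_add\<close>.\<close>
  define g where "g s = C s / (c0 * f (- h0) * f (h0 + s))" for s
  have f': "((\<lambda>s. f (h0 + s)) has_real_derivative deriv f h0) (at 0)"
    using C1_capitalization_factor_deriv(1)[OF f, of h0]
    by (simp add: DERIV_shift[of f _ 0 h0, simplified] add.commute)
  have "C 0 = c0"
    by (simp add: C_def \<nu>0)
  have "((\<lambda>s. c0 * f (- h0) * f (h0 + s)) has_real_derivative c0 * f (- h0) * deriv f h0) (at 0)"
    by (rule DERIV_cmult[OF f'])
  \<comment> \<open>At 0, numerator and denominator share the value \<open>c0\<close> and the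
    derivative \<open>c0 * force_of_interest f h0\<close>, so the quotient rule gives 0.\<close>
  from DERIV_divide[OF C' this] have "(g has_real_derivative 0) (at 0)"
    unfolding g_def[abs_def] using nz c0
    by (simp add: force_of_interest_def minus \<open>C 0 = c0\<close>)
  moreover have "g (s + s') = g s * g s'" for s s'
    using nz c0 by (simp add: g_def C_add minus field_simps)
  moreover have "g 0 = 1"
    using nz c0 \<open>C 0 = c0\<close> by (simp add: g_def minus)
  ultimately have g: "g s = 1" for s
    using multiplicative_eq_exp[of g 0 s] by simp
  have C: "C s = c0 * f (- h0) * f (h0 + s)" for s
    using g[of s] nz c0 by (simp add: g_def)
  fix t
  show "\<nu> t = evolution f (t0, h0, c0) t"
    using \<nu>_eq[of "t - t0"] by (simp add: T H C algebra_simps)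
qed

theorem theorem9:
  fixes f :: "real \<Rightarrow> real" and t0 h0 c0 :: real
  assumes "C1_capitalization_factor f"
    and "c0 \<noteq> 0"
  shows "is_exponential_map t0 (event_monoid f (t0, h0, c0))
           (1, 1, c0 * force_of_interest f h0) (evolution f (t0, h0, c0))"
  unfolding is_exponential_map_def
  using evolution_C1_homomorphism_with_velocity[OF assms]
    C1_homomorphism_with_velocity_eq_evolution[OF assms] by blast

end
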